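(* The hypercube Turán densities of the cycles $C_6$ and $C_{10}$ satisfy \[ \pi_{\square}(C_{10}) \leq \pi_{\square}(C_6). \]
   Context: The $n$-dimensional hypercube $Q_n$ is the graph with vertex set $\{0,1\}^n$ in which two vertices are adjacent if they differ in exactly one coordinate. $C_{2\ell}$ denotes the cycle of length $2\ell$. A copy of a graph $H$ in a graph $G$ is a (not necessarily induced) subgraph of $G$ isomorphic to $H$; $G$ is $H$-free if it contains no copy of $H$. For a graph $H$, $\mathrm{ex}(Q_n,H)$ is the maximum number of edges in an $H$-free subgraph of $Q_n$. Write $e(G)=|E(G)|$. The hypercube Turán density of $H$ is $\pi_\square(H)=\lim_{n\to\infty}\mathrm{ex}(Q_n,H)/e(Q_n)$; the limit exists because the sequence $\mathrm{ex}(Q_n,H)/e(Q_n)$ is non-increasing in $n$. *)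

theory Defs
  imports Complex_Main
begin

text \<open>Simple graphs are pairs of a vertex set and a set of edges, each edge being a
  two-element set of vertices.\<close>

type_synonym 'a graph = "'a set \<times> 'a set set"

abbreviation verts :: "'a graph \<Rightarrow> 'a set" where
  "verts G \<equiv> fst G"

abbreviation edges :: "'a graph \<Rightarrow> 'a set set" where
  "edges G \<equiv> snd G"

definition simple_graph :: "'a graph \<Rightarrow> bool" where
  "simple_graph G \<longleftrightarrow> (\<forall>e \<in> edges G. e \<subseteq> verts G \<and> card e = 2)"

definition subgraph :: "'a graph \<Rightarrow> 'a graph \<Rightarrow> bool" where
  "subgraph K G \<longleftrightarrow> simple_graph K \<and> verts K \<subseteq> verts G \<and> edges K \<subseteq> edges G"

definition graph_isomorphic :: "'a graph \<Rightarrow> 'b graph \<Rightarrow> bool" where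
  "graph_isomorphic G H \<longleftrightarrow>
     (\<exists>f. bij_betw f (verts G) (verts H) \<and>
          (\<forall>u \<in> verts G. \<forall>v \<in> verts G. {u, v} \<in> edges G \<longleftrightarrow> {f u, f v} \<in> edges H))"

definition graph_free :: "'b graph \<Rightarrow> 'a graph \<Rightarrow> bool" where
  "graph_free H G \<longleftrightarrow> \<not> (\<exists>K. subgraph K G \<and> graph_isomorphic K H)"

text \<open>Intended for \<open>k \<ge> 3\<close>.\<close>

definition cycle_graph :: "nat \<Rightarrow> nat graph" where
  "cycle_graph k = ({..<k}, {{i, (i + 1) mod k} | i. i < k})"

text \<open>The set \<open>{0,1}\<^sup>n\<close> is represented by the Boolean lists of length \<open>n\<close>.\<close>

definition hypercube :: "nat \<Rightarrow> bool list graph" where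
  "hypercube n =
     ({x. length x = n},
      {{x, y} | x y. length x = n \<and> length y = n \<and> card {i. i < n \<and> x ! i \<noteq> y ! i} = 1})"

text \<open>The maximum is over a nonempty set whenever \<open>H\<close> has an edge.\<close>

definition hypercube_ex :: "nat \<Rightarrow> 'b graph \<Rightarrow> nat" where
  "hypercube_ex n H = Max {card (edges G) | G. subgraph G (hypercube n) \<and> graph_free H G}"

definition hypercube_turan_density :: "'b graph \<Rightarrow> real" where
  "hypercube_turan_density H =
     lim (\<lambda>n. real (hypercube_ex n H) / real (card (edges (hypercube n))))"

end

theory Submission
  imports Defs
begin

text \<open>
  The heart of the matter is that a \<open>C\<^sub>1\<^sub>0\<close>-free subgraph of \<open>Q\<^sub>n\<close> contains so few hexagons that a
  random subcube of bounded dimension almost surely contains none.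

  Write \<open>x + S\<close> for the vertex \<open>x\<close> with the coordinates in \<open>S\<close> reversed. The vertices at even
  distance along a hexagon are pairwise at distance two, so they have the form \<open>x + a\<close>, \<open>x + b\<close>,
  \<open>x + c\<close>. The vertex between \<open>x + a\<close> and \<open>x + b\<close> is either \<open>x\<close> or \<open>x + ab\<close>, and likewise for the
  other two pairs; since the hexagon passes through \<open>x\<close> at most once, some labelling makes it

    \<open>x + a, x + ab, x + b, x + bc, x + c, y\<close>  where \<open>y\<close> is \<open>x\<close> or \<open>x + ac\<close>.

  Such a configuration is called a corner \<open>(x, a, b, c)\<close> (lemma \<open>hexagon_imp_corner\<close>).

  Fix \<open>x\<close> and \<open>c\<close> and regard the pairs \<open>(a, b)\<close> that complete them to a corner as the edges of a
  digraph on the \<open>n\<close> directions. If it contains a zigzag \<open>a1 b1\<close>, \<open>a2 b1\<close>, \<open>a2 b2\<close> with all four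
  directions distinct, then the three corners together contain the decagon

    \<open>x + a1, x + a1 b1, x + b1, x + a2 b1, x + a2, x + a2 b2, x + b2, x + b2 c, x + c, y\<close>

  with \<open>y\<close> taken from the corner \<open>(x, a1, b1, c)\<close> (lemma \<open>corners_imp_decagon\<close>). It does not matter
  which of its two values \<open>y\<close> takes, so both shapes of hexagon are treated at once. A digraph without
  such a zigzag has at most \<open>3 n\<close> edges (lemma \<open>card_le_if_no_zigzag\<close>). Hence a \<open>C\<^sub>1\<^sub>0\<close>-free
  subgraph of \<open>Q\<^sub>n\<close> has at most \<open>3 n\<^sup>2 2\<^sup>n\<close> corners, a proportion \<open>O(1/n)\<close> of the
  \<open>2\<^sup>n n (n - 1) (n - 2)\<close> conceivable ones.

  Both the edge density and the density of corners are averages of the corresponding densities over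
  the facets (for corners, an upper bound on this average suffices). Descending from \<open>Q\<^sub>n\<close> to a fixed
  \<open>Q\<^sub>m\<close>, where a graph without corners has at most \<open>ex(Q\<^sub>m, C\<^sub>6)\<close> edges, gives
  (lemma \<open>edge_density_le\<close>)

    \<open>edge density of G  \<le>  ex(Q\<^sub>m, C\<^sub>6) / e(Q\<^sub>m) + K\<^sub>m * (corner density of G)\<close>,

  with \<open>K\<^sub>m\<close> independent of \<open>n\<close>. Letting first \<open>n\<close> and then \<open>m\<close> tend to infinity proves the claim.
\<close>

section \<open>Reversing coordinates of a vertex\<close>

definition flip_at :: "nat set \<Rightarrow> bool list \<Rightarrow> bool list" where
  "flip_at S x = map (\<lambda>i. x ! i \<noteq> (i \<in> S)) [0..<length x]"

lemma length_flip_at [simp]: "length (flip_at S x) = length x"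
  by (simp add: flip_at_def)

lemma nth_flip_at [simp]: "i < length x \<Longrightarrow> flip_at S x ! i = (x ! i \<noteq> (i \<in> S))"
  by (simp add: flip_at_def)

lemma flip_at_empty [simp]: "flip_at {} x = x"
  by (rule nth_equalityI) auto

lemma flip_at_flip_at: "flip_at S (flip_at T x) = flip_at (sym_diff S T) x"
  by (rule nth_equalityI) auto

lemma flip_at_eq_iff:
  assumes "S \<subseteq> {..<length x}" "T \<subseteq> {..<length x}"
  shows "flip_at S x = flip_at T x \<longleftrightarrow> S = T"
proof
  assume eq: "flip_at S x = flip_at T x"
  have "i \<in> S \<longleftrightarrow> i \<in> T" if "i < length x" for i
    using arg_cong[OF eq, of "\<lambda>y. y ! i"] that by auto
  then show "S = T" using assms by blast
qed simp

lemma hypercube_edge_iff: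
  "{u, v} \<in> edges (hypercube n) \<longleftrightarrow>
     length u = n \<and> length v = n \<and> card {i. i < n \<and> u ! i \<noteq> v ! i} = 1"
proof
  assume "{u, v} \<in> edges (hypercube n)"
  then obtain x y where "{u, v} = {x, y}" and xy: "length x = n" "length y = n"
      "card {i. i < n \<and> x ! i \<noteq> y ! i} = 1"
    unfolding hypercube_def by auto
  then have "u = x \<and> v = y \<or> u = y \<and> v = x" by (simp add: doubleton_eq_iff)
  moreover have "{i. i < n \<and> y ! i \<noteq> x ! i} = {i. i < n \<and> x ! i \<noteq> y ! i}" by auto
  ultimately show "length u = n \<and> length v = n \<and> card {i. i < n \<and> u ! i \<noteq> v ! i} = 1"
    using xy by (elim disjE) simp_all
next
  assume "length u = n \<and> length v = n \<and> card {i. i < n \<and> u ! i \<noteq> v ! i} = 1"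
  then show "{u, v} \<in> edges (hypercube n)" unfolding hypercube_def snd_conv by blast
qed

lemma hypercube_edge_iff_flip:
  "{u, v} \<in> edges (hypercube n) \<longleftrightarrow> length u = n \<and> (\<exists>d<n. v = flip_at {d} u)"
proof
  assume "{u, v} \<in> edges (hypercube n)"
  then have len: "length u = n" "length v = n" and "card {i. i < n \<and> u ! i \<noteq> v ! i} = 1"
    by (auto simp: hypercube_edge_iff)
  then obtain d where d: "{i. i < n \<and> u ! i \<noteq> v ! i} = {d}"
    by (auto simp: card_1_singleton_iff)
  have "v = flip_at {d} u"
    using len d by (intro nth_equalityI) auto
  then show "length u = n \<and> (\<exists>d<n. v = flip_at {d} u)" using len d by blast
next
  assume "length u = n \<and> (\<exists>d<n. v = flip_at {d} u)"
  then obtain d where "length u = n" "d < n" "v = flip_at {d} u" by blast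
  moreover from this have "{i. i < n \<and> u ! i \<noteq> v ! i} = {d}" by auto
  ultimately show "{u, v} \<in> edges (hypercube n)" by (simp add: hypercube_edge_iff)
qed

lemma hypercube_edge_cases:
  assumes "e \<in> edges (hypercube n)"
  obtains x d where "length x = n" "d < n" "e = {x, flip_at {d} x}"
proof -
  obtain u v where "e = {u, v}" using assms by (auto simp: hypercube_def)
  then show thesis using assms that by (auto simp: hypercube_edge_iff_flip)
qed

lemma flip_at_singleton_neq: "d < length x \<Longrightarrow> flip_at {d} x \<noteq> x"
  using flip_at_eq_iff[of "{d}" x "{}"] by auto

lemma verts_hypercube [simp]: "verts (hypercube n) = {x. length x = n}"
  by (simp add: hypercube_def)

lemma simple_graph_hypercube: "simple_graph (hypercube n)"
  unfolding simple_graph_def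
proof (intro ballI)
  fix e assume "e \<in> edges (hypercube n)"
  then obtain x d where "length x = n" "d < n" "e = {x, flip_at {d} x}"
    by (rule hypercube_edge_cases)
  then show "e \<subseteq> verts (hypercube n) \<and> card e = 2"
    using flip_at_singleton_neq[of d x] by (auto simp: card_2_iff)
qed

lemma card_bool_lists: "card {x :: bool list. length x = n} = 2 ^ n"
  using card_lists_length_eq[of "UNIV :: bool set" n] by simp

lemma finite_bool_lists: "finite {x :: bool list. length x = n}"
  using finite_lists_length_eq[of "UNIV :: bool set" n] by simp

lemma finite_edges_hypercube: "finite (edges (hypercube n))"
proof (rule finite_subset)
  show "edges (hypercube n) \<subseteq> Pow {x. length x = n}"
    using simple_graph_hypercube[of n] by (auto simp: simple_graph_def)
qed (simp add: finite_bool_lists)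

section \<open>Cycles and extremal numbers\<close>

text \<open>A homomorphic closed walk suffices once it is injective: adjacency in the cycle is then reflected
  because the image of a pair determines the pair.\<close>

lemma contains_cycle_iff:
  assumes G: "simple_graph G"
  shows "\<not> graph_free (cycle_graph k) G \<longleftrightarrow>
    (\<exists>v. inj_on v {..<k} \<and> (\<forall>i<k. {v i, v ((i + 1) mod k)} \<in> edges G))"
proof
  assume "\<not> graph_free (cycle_graph k) G"
  then obtain K f where K: "subgraph K G" and bij: "bij_betw f (verts K) {..<k}"
    and f: "\<And>u w. u \<in> verts K \<Longrightarrow> w \<in> verts K \<Longrightarrow>
      {u, w} \<in> edges K \<longleftrightarrow> {f u, f w} \<in> edges (cycle_graph k)"
    by (auto simp: graph_free_def graph_isomorphic_def cycle_graph_def)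
  let ?v = "inv_into (verts K) f"
  have v: "?v i \<in> verts K" "f (?v i) = i" if "i < k" for i
    using bij that by (auto simp: bij_betw_def inv_into_into f_inv_into_f)
  have "inj_on ?v {..<k}" using bij by (simp add: bij_betw_def inj_on_inv_into)
  moreover have "{?v i, ?v ((i + 1) mod k)} \<in> edges G" if "i < k" for i
  proof -
    have "(i + 1) mod k < k" using that by simp
    then have "{?v i, ?v ((i + 1) mod k)} \<in> edges K"
      using f[of "?v i" "?v ((i + 1) mod k)"] v that by (auto simp: cycle_graph_def)
    then show ?thesis using K by (auto simp: subgraph_def)
  qed
  ultimately show "\<exists>v. inj_on v {..<k} \<and> (\<forall>i<k. {v i, v ((i + 1) mod k)} \<in> edges G)" by blast
next
  assume "\<exists>v. inj_on v {..<k} \<and> (\<forall>i<k. {v i, v ((i + 1) mod k)} \<in> edges G)"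
  then obtain v where inj: "inj_on v {..<k}"
    and v: "\<And>i. i < k \<Longrightarrow> {v i, v ((i + 1) mod k)} \<in> edges G" by blast
  define K where "K = (v ` {..<k}, (`) v ` edges (cycle_graph k))"
  have sub: "e \<subseteq> {..<k}" if "e \<in> edges (cycle_graph k)" for e
    using that by (auto simp: cycle_graph_def)
  have KG: "edges K \<subseteq> edges G" using v by (auto simp: K_def cycle_graph_def)
  have "v i \<in> verts G" if "i < k" for i
    using v[OF that] G by (auto simp: simple_graph_def)
  moreover have "e \<subseteq> verts K" if "e \<in> edges K" for e
    using that sub by (fastforce simp: K_def)
  ultimately have "subgraph K G"
    using KG G unfolding subgraph_def simple_graph_def by (auto simp: K_def)
  moreover have "graph_isomorphic K (cycle_graph k)"
    unfolding graph_isomorphic_def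
  proof (intro exI conjI ballI)
    let ?f = "inv_into {..<k} v"
    show "bij_betw ?f (verts K) (verts (cycle_graph k))"
      using inj by (simp add: K_def cycle_graph_def bij_betw_inv_into inj_on_imp_bij_betw)
    fix u w assume "u \<in> verts K" "w \<in> verts K"
    then obtain i j where ij: "u = v i" "w = v j" "i < k" "j < k" by (auto simp: K_def)
    have "{u, w} \<in> edges K \<longleftrightarrow> v ` {i, j} \<in> (`) v ` edges (cycle_graph k)"
      by (simp add: K_def ij)
    also have "\<dots> \<longleftrightarrow> {i, j} \<in> edges (cycle_graph k)"
    proof
      assume "v ` {i, j} \<in> (`) v ` edges (cycle_graph k)"
      then obtain e where e: "e \<in> edges (cycle_graph k)" "v ` {i, j} = v ` e" by blast
      then have "{i, j} = e"
        using inj_on_image_eq_iff[OF inj, of "{i, j}" e] sub ij by auto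
      then show "{i, j} \<in> edges (cycle_graph k)" using e by simp
    qed blast
    finally show "{u, w} \<in> edges K \<longleftrightarrow> {?f u, ?f w} \<in> edges (cycle_graph k)"
      using ij inj by simp
  qed
  ultimately show "\<not> graph_free (cycle_graph k) G" unfolding graph_free_def by blast
qed

lemma hypercube_ex_set_finite:
  "finite {card (edges G) | G. subgraph G (hypercube n) \<and> graph_free H G}"
proof (rule finite_subset)
  show "{card (edges G) | G. subgraph G (hypercube n) \<and> graph_free H G}
      \<subseteq> {..card (edges (hypercube n))}"
    by (auto simp: subgraph_def intro!: card_mono finite_edges_hypercube)
qed simp

lemma card_edges_le_hypercube_ex:
  assumes "subgraph G (hypercube n)" "graph_free H G"
  shows "card (edges G) \<le> hypercube_ex n H"
  unfolding hypercube_ex_def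
  using assms by (intro Max_ge hypercube_ex_set_finite) blast

text \<open>The maximum is taken over a nonempty set because a graph with a vertex is not contained in the
  graph without vertices.\<close>

lemma hypercube_ex_attained:
  assumes "verts H \<noteq> {}"
  obtains G where "subgraph G (hypercube n)" "graph_free H G" "card (edges G) = hypercube_ex n H"
proof -
  have "subgraph ({}, {}) (hypercube n)" by (simp add: subgraph_def simple_graph_def)
  moreover have "graph_free H ({}, {})"
    using assms by (auto simp: graph_free_def subgraph_def graph_isomorphic_def bij_betw_def)
  ultimately have "{card (edges G) | G. subgraph G (hypercube n) \<and> graph_free H G} \<noteq> {}"
    by blast
  from Max_in[OF hypercube_ex_set_finite this] show thesis
    using that by (auto simp: hypercube_ex_def)
qed

text \<open>The facets of a hypercube are handled as pullbacks along embeddings of the next smaller hypercube.\<close>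

definition pullback_graph :: "('a \<Rightarrow> 'b) \<Rightarrow> 'a graph \<Rightarrow> 'b graph \<Rightarrow> 'a graph" where
  "pullback_graph h Q G = ({x \<in> verts Q. h x \<in> verts G}, {e \<in> edges Q. h ` e \<in> edges G})"

lemma subgraph_pullback_graph:
  assumes "simple_graph Q" "simple_graph G"
  shows "subgraph (pullback_graph h Q G) Q"
  using assms unfolding subgraph_def simple_graph_def pullback_graph_def by fastforce

text \<open>An injection carries a copy of \<open>H\<close> in the pullback to a copy of \<open>H\<close> in \<open>G\<close>.\<close>

lemma graph_free_pullback_graph:
  assumes inj: "inj_on h (verts Q)" and Q: "simple_graph Q" and G: "simple_graph G"
    and free: "graph_free H G"
  shows "graph_free H (pullback_graph h Q G)"
proof (rule ccontr)
  assume "\<not> graph_free H (pullback_graph h Q G)"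
  then obtain K f where K: "subgraph K (pullback_graph h Q G)"
    and bij: "bij_betw f (verts K) (verts H)"
    and f: "\<And>u w. u \<in> verts K \<Longrightarrow> w \<in> verts K \<Longrightarrow>
      {u, w} \<in> edges K \<longleftrightarrow> {f u, f w} \<in> edges H"
    by (auto simp: graph_free_def graph_isomorphic_def)
  have KV: "verts K \<subseteq> verts Q" "h ` verts K \<subseteq> verts G"
    and KE: "\<And>e. e \<in> edges K \<Longrightarrow> h ` e \<in> edges G \<and> e \<subseteq> verts K"
    using K by (auto simp: subgraph_def simple_graph_def pullback_graph_def)
  have injK: "inj_on h (verts K)" using inj KV(1) by (rule inj_on_subset)
  define L where "L = (h ` verts K, (`) h ` edges K)"
  have "subgraph L G"
    using KV KE G unfolding subgraph_def simple_graph_def L_def by fastforce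
  moreover have "graph_isomorphic L H"
    unfolding graph_isomorphic_def
  proof (intro exI conjI ballI)
    let ?g = "f \<circ> inv_into (verts K) h"
    show "bij_betw ?g (verts L) (verts H)"
      using bij injK
      by (auto simp: L_def intro!: bij_betw_trans bij_betw_inv_into inj_on_imp_bij_betw)
    fix u w assume "u \<in> verts L" "w \<in> verts L"
    then obtain i j where ij: "u = h i" "w = h j" "i \<in> verts K" "j \<in> verts K"
      by (auto simp: L_def)
    have "{u, w} \<in> edges L \<longleftrightarrow> h ` {i, j} \<in> (`) h ` edges K" by (simp add: L_def ij)
    also have "\<dots> \<longleftrightarrow> {i, j} \<in> edges K"
    proof
      assume "h ` {i, j} \<in> (`) h ` edges K"
      then obtain e where e: "e \<in> edges K" "h ` {i, j} = h ` e" by blast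
      then have "{i, j} = e"
        using inj_on_image_eq_iff[OF injK, of "{i, j}" e] KE ij by auto
      then show "{i, j} \<in> edges K" using e by simp
    qed blast
    finally show "{u, w} \<in> edges L \<longleftrightarrow> {?g u, ?g w} \<in> edges H"
      using ij injK f by simp
  qed
  ultimately show False using free unfolding graph_free_def by blast
qed

section \<open>Corners\<close>

text \<open>The two disjuncts at the end are the two positions of the sixth vertex, \<open>x\<close> and \<open>x + ac\<close>. The
  former occurs for the hexagons around two faces of a 3-cube that share an edge, the latter for the
  hexagons that avoid an antipodal pair of the 3-cube.\<close>

definition corner :: "bool list set set \<Rightarrow> bool list \<Rightarrow> nat \<Rightarrow> nat \<Rightarrow> nat \<Rightarrow> bool" where
  "corner E x a b c \<longleftrightarrow>
     (let adj = (\<lambda>S T. {flip_at S x, flip_at T x} \<in> E) in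
        adj {a} {a, b} \<and> adj {a, b} {b} \<and> adj {b} {b, c} \<and> adj {b, c} {c} \<and>
        (adj {c} {} \<and> adj {} {a} \<or> adj {c} {a, c} \<and> adj {a, c} {a}))"

definition corners :: "nat \<Rightarrow> bool list set set \<Rightarrow> (bool list \<times> nat \<times> nat \<times> nat) set" where
  "corners n E = {(x, a, b, c). length x = n \<and> a < n \<and> b < n \<and> c < n \<and>
     a \<noteq> b \<and> b \<noteq> c \<and> a \<noteq> c \<and> corner E x a b c}"

lemma finite_corners: "finite (corners n E)"
proof (rule finite_subset)
  show "corners n E \<subseteq> {x. length x = n} \<times> {..<n} \<times> {..<n} \<times> {..<n}"
    by (auto simp: corners_def)
qed (simp add: finite_bool_lists)

lemma common_neighbour:
  assumes "{flip_at {p} x, v} \<in> edges (hypercube n)" "{v, flip_at {q} x} \<in> edges (hypercube n)"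
    and pq: "p \<noteq> q" "p < n" "q < n"
  shows "v = x \<or> v = flip_at {p, q} x"
proof -
  have "{flip_at {q} x, v} \<in> edges (hypercube n)" using assms(2) by (simp add: insert_commute)
  then obtain d e where de: "length x = n" "d < n" "e < n"
    "v = flip_at {d} (flip_at {p} x)" "v = flip_at {e} (flip_at {q} x)"
    using assms(1) by (auto simp: hypercube_edge_iff_flip)
  then have "sym_diff {d} {p} = sym_diff {e} {q}"
    using pq by (subst flip_at_eq_iff[of _ x, symmetric]) (auto simp: flip_at_flip_at)
  then have "d = p \<or> d = q" using pq by auto
  then show ?thesis using de pq by (auto simp: flip_at_flip_at insert_commute Un_commute)
qed

text \<open>If \<open>v0, ..., v5\<close> is the hexagon, then \<open>v2\<close> and \<open>v4\<close> arise from \<open>v0\<close> by reversing two coordinates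
  each. The two pairs of coordinates share exactly one coordinate \<open>p\<close>, because \<open>v2\<close> and \<open>v4\<close> are
  themselves at distance two. With \<open>x = v0 + p\<close> the vertices \<open>v0, v2, v4\<close> become \<open>x + p\<close>, \<open>x + q\<close>,
  \<open>x + r\<close>, and a rotation moves the vertex equal to \<open>x\<close>, if there is one, to the last place.\<close>

lemma hexagon_imp_corner:
  assumes sub: "subgraph G (hypercube n)" and nfree: "\<not> graph_free (cycle_graph 6) G"
  shows "corners n (edges G) \<noteq> {}"
proof -
  have "simple_graph G" using sub by (simp add: subgraph_def)
  with nfree obtain v where inj: "inj_on v {..<6::nat}"
    and v: "\<And>i. i < 6 \<Longrightarrow> {v i, v ((i + 1) mod 6)} \<in> edges G"
    using contains_cycle_iff by blast
  have EG: "{v 0, v 1} \<in> edges G" "{v 1, v 2} \<in> edges G" "{v 2, v 3} \<in> edges G"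
    "{v 3, v 4} \<in> edges G" "{v 4, v 5} \<in> edges G" "{v 5, v 0} \<in> edges G"
    using v[of 0] v[of 1] v[of 2] v[of 3] v[of 4] v[of 5] by (simp_all flip: numeral_2_eq_2)
  have E': "{v 1, v 0} \<in> edges G" "{v 2, v 1} \<in> edges G" "{v 3, v 2} \<in> edges G"
    "{v 4, v 3} \<in> edges G" "{v 5, v 4} \<in> edges G" "{v 0, v 5} \<in> edges G"
    using EG by (simp_all add: insert_commute)
  have sub': "e \<in> edges G \<Longrightarrow> e \<in> edges (hypercube n)" for e
    using sub by (auto simp: subgraph_def)
  note EQ = EG[THEN sub'] and EQ' = E'[THEN sub']
  have neq: "v i \<noteq> v j" if "i < 6" "j < 6" "i \<noteq> j" for i j
    using inj that by (auto simp: inj_on_def)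
  define u where "u = v 0"
  obtain d0 d1 d2 d3 d4 d5 where d: "d0 < n" "d1 < n" "d2 < n" "d3 < n" "d4 < n" "d5 < n"
    and len: "length u = n"
    and v1: "v 1 = flip_at {d0} u" and v2: "v 2 = flip_at {d1} (v 1)"
    and v3: "v 3 = flip_at {d2} (v 2)" and v4: "v 4 = flip_at {d3} (v 3)"
    and v5: "v 5 = flip_at {d5} u" and v4': "v 4 = flip_at {d4} (v 5)"
    using EQ(1-4) EQ'(5,6) unfolding hypercube_edge_iff_flip u_def by blast
  have d01: "d0 \<noteq> d1" using neq[of 2 0] v2 v1 by (auto simp: flip_at_flip_at u_def)
  have d23: "d2 \<noteq> d3" using neq[of 4 2] v4 v3 by (auto simp: flip_at_flip_at)
  have d45: "d4 \<noteq> d5" using neq[of 4 0] v4' v5 by (auto simp: flip_at_flip_at u_def)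
  have d50: "d5 \<noteq> d0" using neq[of 5 1] v5 v1 by auto
  have v2u: "v 2 = flip_at {d0, d1} u" and v4u: "v 4 = flip_at {d4, d5} u"
    using v1 v2 v5 v4' d01 d45 by (auto simp: flip_at_flip_at insert_commute)
  have "flip_at (sym_diff {d3} (sym_diff {d2} {d0, d1})) u = flip_at {d4, d5} u"
    using v3 v4 v4u v2u by (simp add: flip_at_flip_at)
  then have cyc: "sym_diff {d3} (sym_diff {d2} {d0, d1}) = {d4, d5}"
    using d len by (subst (asm) flip_at_eq_iff) auto
  have d24: "{d0, d1} \<noteq> {d4, d5}" using neq[of 2 4] v2u v4u by auto
  obtain p q r where pqr: "{d0, d1} = {p, q}" "{d4, d5} = {p, r}" "p \<noteq> q" "q \<noteq> r" "p \<noteq> r"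
  proof -
    \<comment> \<open>If the pairs were disjoint, the remaining two steps could not lead from \<open>v2\<close> to \<open>v4\<close>.\<close>
    have "d0 = d4 \<or> d1 = d4 \<or> d1 = d5"
    proof (rule ccontr)
      assume "\<not> ?thesis"
      then have "d0 \<notin> {d4, d5}" "d1 \<notin> {d4, d5}" using d50 by auto
      then have "{d0, d1} = {d2, d3}" using cyc d01 d23 by blast
      then have "sym_diff {d3} (sym_diff {d2} {d0, d1}) = {}" using d23 by auto
      then show False using cyc by auto
    qed
    then show thesis
    proof (elim disjE)
      assume "d0 = d4" then show thesis using that[of d0 d1 d5] d01 d45 d24 by auto
    next
      assume "d1 = d4" then show thesis using that[of d1 d0 d5] d01 d45 d24 by auto
    next
      assume "d1 = d5" then show thesis using that[of d1 d0 d4] d01 d45 d24 by auto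
    qed
  qed
  have lt: "p < n" "q < n" "r < n" using pqr(1,2) d by (auto simp: doubleton_eq_iff)
  define x where "x = flip_at {p} u"
  have lx: "length x = n" by (simp add: x_def len)
  have w: "v 0 = flip_at {p} x" "v 2 = flip_at {q} x" "v 4 = flip_at {r} x"
    using v2u v4u pqr by (auto simp: x_def u_def flip_at_flip_at insert_commute insert_Diff_if)
  have m1: "v 1 = x \<or> v 1 = flip_at {p, q} x"
    using common_neighbour[of p x "v 1" n q] EQ pqr lt w by simp
  have m3: "v 3 = x \<or> v 3 = flip_at {q, r} x"
    using common_neighbour[of q x "v 3" n r] EQ pqr lt w by simp
  have m5: "v 5 = x \<or> v 5 = flip_at {r, p} x"
    using common_neighbour[of r x "v 5" n p] EQ pqr lt w by simp
  have n13: "v 1 \<noteq> v 3" "v 1 \<noteq> v 5" "v 3 \<noteq> v 5" using neq[of 1 3] neq[of 1 5] neq[of 3 5] by simp_all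
  consider "v 1 = x" | "v 3 = x" | "v 1 \<noteq> x" "v 3 \<noteq> x" by blast
  then have "corner (edges G) x p q r \<or> corner (edges G) x q r p \<or> corner (edges G) x r p q"
  proof cases
    case 1
    then have "v 3 = flip_at {q, r} x" "v 5 = flip_at {r, p} x" using m3 m5 n13 by auto
    then have "corner (edges G) x q r p"
      using EG 1 w by (simp add: corner_def insert_commute)
    then show ?thesis by blast
  next
    case 2
    then have "v 1 = flip_at {p, q} x" "v 5 = flip_at {r, p} x" using m1 m5 n13 by auto
    then have "corner (edges G) x r p q"
      using EG 2 w by (simp add: corner_def insert_commute)
    then show ?thesis by blast
  next
    case 3
    then have "v 1 = flip_at {p, q} x" "v 3 = flip_at {q, r} x" using m1 m3 by auto
    then have "corner (edges G) x p q r"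
      using EG E' m5 w by (auto simp: corner_def insert_commute)
    then show ?thesis by blast
  qed
  then show ?thesis using lt lx pqr by (auto simp: corners_def)
qed

text \<open>The decagon runs through \<open>x + a1\<close>, \<open>x + b1\<close>, \<open>x + a2\<close>, \<open>x + b2\<close>, \<open>x + c\<close>. Of the five paths of
  length two between them, the first corner provides the one from \<open>x + a1\<close> to \<open>x + b1\<close> and, through
  \<open>x + Y\<close>, the one from \<open>x + c\<close> back to \<open>x + a1\<close>; the second corner provides the next one, and the third
  corner the two from \<open>x + a2\<close> to \<open>x + b2\<close> and on to \<open>x + c\<close>.\<close>

lemma corners_imp_decagon:
  assumes G: "simple_graph G" and lx: "length x = n"
    and lt: "a1 < n" "b1 < n" "a2 < n" "b2 < n" "c < n"
    and dist: "distinct [a1, b1, a2, b2, c]"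
    and cor: "corner (edges G) x a1 b1 c" "corner (edges G) x a2 b1 c" "corner (edges G) x a2 b2 c"
  shows "\<not> graph_free (cycle_graph 10) G"
proof -
  obtain Y where Y: "Y = {} \<or> Y = {a1, c}"
    "{flip_at {c} x, flip_at Y x} \<in> edges G" "{flip_at Y x, flip_at {a1} x} \<in> edges G"
    using cor(1) unfolding corner_def Let_def by blast
  let ?Ss = "[{a1}, {a1, b1}, {b1}, {a2, b1}, {a2}, {a2, b2}, {b2}, {b2, c}, {c}, Y]"
  define vs where "vs = map (\<lambda>S. flip_at S x) ?Ss"
  have "distinct ?Ss" using dist Y(1) by (auto simp: doubleton_eq_iff)
  moreover have "inj_on (\<lambda>S. flip_at S x) (set ?Ss)"
  proof (rule inj_onI)
    fix S T assume "S \<in> set ?Ss" "T \<in> set ?Ss" "flip_at S x = flip_at T x"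
    moreover from this have "S \<subseteq> {..<length x}" "T \<subseteq> {..<length x}" using lt lx Y(1) by auto
    ultimately show "S = T" by (simp add: flip_at_eq_iff)
  qed
  ultimately have "distinct vs" unfolding vs_def distinct_map by blast
  moreover have "length vs = 10" by (simp add: vs_def)
  ultimately have "inj_on ((!) vs) {..<10}" by (simp add: inj_on_nth)
  moreover have "{vs ! i, vs ! ((i + 1) mod 10)} \<in> edges G" if "i < 10" for i
  proof -
    have "i \<in> set [0..<10]" using that by simp
    then have "i = 0 \<or> i = 1 \<or> i = 2 \<or> i = 3 \<or> i = 4 \<or> i = 5 \<or> i = 6 \<or> i = 7 \<or> i = 8 \<or> i = 9"
      by auto
    then show ?thesis
      using cor Y(2,3) by (elim disjE) (auto simp: vs_def corner_def Let_def insert_commute)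
  qed
  ultimately show ?thesis unfolding contains_cycle_iff[OF G] by blast
qed

text \<open>Suppose that the edge \<open>(a, b)\<close> has \<open>a\<close> of out-degree at least 3 and \<open>b\<close> of in-degree at least 2.
  Then it is the middle of a zigzag: choose another edge \<open>(a', b)\<close>, and then an edge \<open>(a, b')\<close> with
  \<open>b'\<close> different from \<open>b\<close> and from \<open>a'\<close>. Hence without zigzags every edge is one of at most 2 leaving
  its tail or the only one entering its head, which leaves at most \<open>2 n + n\<close> edges.\<close>

lemma card_le_if_no_zigzag:
  fixes D :: "(nat \<times> nat) set"
  assumes D: "D \<subseteq> {..<n} \<times> {..<n}"
    and no: "\<And>a1 b1 a2 b2. (a1, b1) \<in> D \<Longrightarrow> (a2, b1) \<in> D \<Longrightarrow> (a2, b2) \<in> D \<Longrightarrow>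
      a1 \<noteq> a2 \<Longrightarrow> b1 \<noteq> b2 \<Longrightarrow> a1 = b2"
  shows "card D \<le> 3 * n"
proof -
  define out where "out a = {b. (a, b) \<in> D}" for a
  define inn where "inn b = {a. (a, b) \<in> D}" for b
  have fin: "finite (out a)" "finite (inn b)" for a b
    using D by (auto simp: out_def inn_def intro!: finite_subset[of _ "{..<n}"])
  let ?D1 = "SIGMA a:{..<n}. if card (out a) \<le> 2 then out a else {}"
  let ?D2 = "SIGMA b:{..<n}. if card (inn b) \<le> 1 then inn b else {}"
  have "D \<subseteq> ?D1 \<union> prod.swap ` ?D2"
  proof
    fix e assume "e \<in> D"
    then obtain a b where e: "e = (a, b)" and ab: "(a, b) \<in> D" by (cases e) auto
    have "card (out a) \<le> 2 \<or> card (inn b) \<le> 1"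
    proof (rule ccontr)
      assume "\<not> ?thesis"
      then have big: "card (out a) > 2" "card (inn b) > 1" by auto
      have "inn b - {a} \<noteq> {}"
        using big(2) card_mono[of "{a}" "inn b"] by auto
      then obtain a' where a': "(a', b) \<in> D" "a' \<noteq> a" by (auto simp: inn_def)
      have "card {b, a'} \<le> 2" by (simp add: card_insert_if)
      then have "\<not> out a \<subseteq> {b, a'}"
        using big(1) card_mono[of "{b, a'}" "out a"] by auto
      then obtain b' where "(a, b') \<in> D" "b' \<noteq> b" "b' \<noteq> a'" by (auto simp: out_def)
      then show False using no[of a' b a b'] a' ab by auto
    qed
    moreover have "a < n" "b < n" using ab D by auto
    ultimately show "e \<in> ?D1 \<union> prod.swap ` ?D2"
      using ab e by (force simp: out_def inn_def)
  qed
  then have "card D \<le> card (?D1 \<union> prod.swap ` ?D2)"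
    using fin by (intro card_mono) auto
  also have "\<dots> \<le> card ?D1 + card (prod.swap ` ?D2)" by (rule card_Un_le)
  also have "\<dots> \<le> card ?D1 + card ?D2"
    using fin by (intro add_left_mono card_image_le) auto
  also have "card ?D1 = (\<Sum>a<n. card (if card (out a) \<le> 2 then out a else {}))"
    using fin by simp
  also have "\<dots> \<le> (\<Sum>a<n. 2)" by (rule sum_mono) simp
  also have "card ?D2 = (\<Sum>b<n. card (if card (inn b) \<le> 1 then inn b else {}))"
    using fin by simp
  also have "\<dots> \<le> (\<Sum>b<n. 1)" by (rule sum_mono) simp
  finally show ?thesis by simp
qed

lemma card_corners_le:
  assumes sub: "subgraph G (hypercube n)" and free: "graph_free (cycle_graph 10) G"
  shows "card (corners n (edges G)) \<le> 2 ^ n * (n * (3 * n))"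
proof -
  have G: "simple_graph G" using sub by (simp add: subgraph_def)
  define D where "D x c = {(a, b). (x, a, b, c) \<in> corners n (edges G)}" for x c
  have Dsub: "D x c \<subseteq> {..<n} \<times> {..<n}" for x c by (auto simp: D_def corners_def)
  then have fin: "finite (D x c)" for x c by (rule finite_subset) simp
  have bound: "card (D x c) \<le> 3 * n" for x c
  proof (rule card_le_if_no_zigzag[OF Dsub])
    fix a1 b1 a2 b2
    assume "(a1, b1) \<in> D x c" "(a2, b1) \<in> D x c" "(a2, b2) \<in> D x c" "a1 \<noteq> a2" "b1 \<noteq> b2"
    then show "a1 = b2"
      using corners_imp_decagon[OF G, of x n a1 b1 a2 b2 c] free
      by (auto simp: D_def corners_def)
  qed
  let ?S = "SIGMA x:{x. length x = n}. SIGMA c:{..<n}. D x c"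
  have finS: "finite ?S" using fin by (intro finite_SigmaI finite_bool_lists) auto
  have "corners n (edges G) \<subseteq> (\<lambda>(x, c, a, b). (x, a, b, c)) ` ?S"
    by (force simp: D_def corners_def)
  then have "card (corners n (edges G)) \<le> card ?S" by (rule surj_card_le[OF finS])
  also have "\<dots> = (\<Sum>x\<in>{x. length x = n}. \<Sum>c<n. card (D x c))"
    using fin finite_bool_lists[of n] by simp
  also have "\<dots> \<le> (\<Sum>x\<in>{x :: bool list. length x = n}. \<Sum>c<n. 3 * n)"
    by (intro sum_mono bound)
  finally show ?thesis by (simp add: card_bool_lists)
qed

section \<open>Averaging over facets\<close>

text \<open>The facet of \<open>Q\<^sub>n\<^sub>+\<^sub>1\<close> on which coordinate \<open>i\<close> has the value \<open>t\<close> is the image of \<open>Q\<^sub>n\<close> under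
  \<open>insert_bit i t\<close>; this embedding renames the direction \<open>d\<close> to \<open>skip i d\<close>.\<close>

definition insert_bit :: "nat \<Rightarrow> bool \<Rightarrow> bool list \<Rightarrow> bool list" where
  "insert_bit i t x = take i x @ t # drop i x"

definition skip :: "nat \<Rightarrow> nat \<Rightarrow> nat" where
  "skip i d = (if d < i then d else Suc d)"

lemma length_insert_bit [simp]: "length (insert_bit i t x) = Suc (length x)"
  by (simp add: insert_bit_def)

lemma nth_insert_bit:
  assumes "i \<le> length x"
  shows "insert_bit i t x ! i = t"
    and "d < length x \<Longrightarrow> insert_bit i t x ! skip i d = x ! d"
  using assms by (auto simp: insert_bit_def skip_def nth_append min_def Suc_diff_le)

lemma skip_eq_iff [simp]: "skip i d = skip i d' \<longleftrightarrow> d = d'"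
  by (auto simp: skip_def)

lemma skip_neq [simp]: "skip i d \<noteq> i" "i \<noteq> skip i d"
  by (auto simp: skip_def)

lemma skip_less_iff: "i \<le> n \<Longrightarrow> skip i d < Suc n \<longleftrightarrow> d < n"
  by (auto simp: skip_def)

lemma skip_cases:
  assumes "j \<noteq> i"
  obtains d where "j = skip i d"
  using assms that[of j] that[of "j - 1"] by (cases "j < i") (auto simp: skip_def)

lemma insert_bit_eq_iff:
  assumes "length x = n" "length y = n" "i \<le> n"
  shows "insert_bit i t x = insert_bit i s y \<longleftrightarrow> t = s \<and> x = y"
proof
  assume "insert_bit i t x = insert_bit i s y"
  then have "take i x = take i y" "t = s" "drop i x = drop i y"
    using assms by (auto simp: insert_bit_def)
  then show "t = s \<and> x = y" by (metis append_take_drop_id)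
qed simp

lemma insert_bit_cases:
  assumes "length y = Suc n" "i \<le> n"
  obtains t x where "length x = n" "y = insert_bit i t x"
proof
  show "length (take i y @ drop (Suc i) y) = n" using assms by simp
  show "y = insert_bit i (y ! i) (take i y @ drop (Suc i) y)"
    using assms id_take_nth_drop[of i y] by (simp add: insert_bit_def min_def)
qed

lemma flip_at_insert_bit:
  assumes "i \<le> length x"
  shows "flip_at (skip i ` S) (insert_bit i t x) = insert_bit i t (flip_at S x)"
proof (rule nth_equalityI)
  fix j assume j: "j < length (flip_at (skip i ` S) (insert_bit i t x))"
  show "flip_at (skip i ` S) (insert_bit i t x) ! j = insert_bit i t (flip_at S x) ! j"
  proof (cases "j = i")
    case True
    then show ?thesis using assms by (auto simp: nth_insert_bit)
  next
    case False
    then obtain d where d: "j = skip i d" by (rule skip_cases)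
    then have "d < length x" using j assms by (simp add: skip_less_iff)
    then show ?thesis using assms j by (auto simp: d nth_insert_bit)
  qed
qed simp

definition facet :: "nat \<Rightarrow> nat \<Rightarrow> bool \<Rightarrow> bool list graph \<Rightarrow> bool list graph" where
  "facet n i t G = pullback_graph (insert_bit i t) (hypercube n) G"

lemma subgraph_facet: "simple_graph G \<Longrightarrow> subgraph (facet n i t G) (hypercube n)"
  by (simp add: facet_def subgraph_pullback_graph simple_graph_hypercube)

lemma graph_free_facet:
  assumes "simple_graph G" "graph_free H G" "i \<le> n"
  shows "graph_free H (facet n i t G)"
  unfolding facet_def
  using assms
  by (intro graph_free_pullback_graph simple_graph_hypercube)
     (auto simp: inj_on_def insert_bit_eq_iff)

lemma edge_facet_imp:
  assumes "{flip_at S x, flip_at T x} \<in> edges (facet n i t G)" "length x = n" "i \<le> n"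
  shows "{flip_at (skip i ` S) (insert_bit i t x), flip_at (skip i ` T) (insert_bit i t x)} \<in> edges G"
  using assms by (simp add: facet_def pullback_graph_def flip_at_insert_bit)

lemma corner_facet:
  assumes "corner (edges (facet n i t G)) x a b c" "length x = n" "i \<le> n"
  shows "corner (edges G) (insert_bit i t x) (skip i a) (skip i b) (skip i c)"
proof -
  have *: "{flip_at (skip i ` S) (insert_bit i t x), flip_at (skip i ` T) (insert_bit i t x)} \<in> edges G"
    if "{flip_at S x, flip_at T x} \<in> edges (facet n i t G)" for S T
    using edge_facet_imp[OF that assms(2,3)] .
  show ?thesis
    using assms(1) *[of "{a}" "{a, b}"] *[of "{a, b}" "{b}"] *[of "{b}" "{b, c}"]
      *[of "{b, c}" "{c}"] *[of "{c}" "{}"] *[of "{}" "{a}"] *[of "{c}" "{a, c}"] *[of "{a, c}" "{a}"]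
    unfolding corner_def Let_def by auto
qed

text \<open>Edges are counted from both ends, as pairs of a vertex and a direction, because these transfer to
  facets in the same way as the tuples that form corners.\<close>

definition arcs :: "nat \<Rightarrow> bool list set set \<Rightarrow> (bool list \<times> nat) set" where
  "arcs n E = {(x, d). length x = n \<and> d < n \<and> {x, flip_at {d} x} \<in> E}"

lemma finite_arcs: "finite (arcs n E)"
proof (rule finite_subset)
  show "arcs n E \<subseteq> {x. length x = n} \<times> {..<n}" by (auto simp: arcs_def)
qed (simp add: finite_bool_lists)

lemma card_arcs:
  assumes "E \<subseteq> edges (hypercube n)"
  shows "card (arcs n E) = 2 * card E"
proof -
  let ?f = "\<lambda>(x, d). {x, flip_at {d} x}"
  have fin: "finite E" using assms finite_edges_hypercube finite_subset by blast
  have "?f ` arcs n E \<subseteq> E" by (auto simp: arcs_def)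
  then have "(\<Sum>p\<in>arcs n E. 1) = (\<Sum>e\<in>E. \<Sum>p | p \<in> arcs n E \<and> ?f p = e. (1::nat))"
    using sum.group[of "arcs n E" E ?f "\<lambda>_. 1::nat"] finite_arcs fin by simp
  also have "\<dots> = (\<Sum>e\<in>E. 2)"
  proof (rule sum.cong[OF refl])
    fix e assume e: "e \<in> E"
    then obtain x d where xd: "length x = n" "d < n" "e = {x, flip_at {d} x}"
      using assms hypercube_edge_cases by blast
    have flip2: "flip_at {d} (flip_at {d} x) = x" by (simp add: flip_at_flip_at)
    have ne: "flip_at {d} x \<noteq> x" using xd flip_at_singleton_neq by blast
    have inj: "d' = d" if "flip_at {d'} x = flip_at {d} x" "d' < n" for d'
      using that xd flip_at_eq_iff[of "{d'}" x "{d}"] by simp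
    have inj': "d' = d" if "flip_at {d'} (flip_at {d} x) = x" "d' < n" for d'
      using that xd flip2 flip_at_eq_iff[of "{d'}" "flip_at {d} x" "{d}"] by simp
    have "{p. p \<in> arcs n E \<and> ?f p = e} = {(x, d), (flip_at {d} x, d)}"
      using e xd flip2 inj inj'
      by (auto simp: arcs_def doubleton_eq_iff insert_commute)
    then show "(\<Sum>p | p \<in> arcs n E \<and> ?f p = e. 1) = (2::nat)" using ne by auto
  qed
  finally show ?thesis by simp
qed

lemma card_edges_hypercube: "2 * card (edges (hypercube n)) = n * 2 ^ n"
proof -
  have "arcs n (edges (hypercube n)) = {x. length x = n} \<times> {..<n}"
    by (auto simp: arcs_def hypercube_edge_iff_flip)
  then show ?thesis using card_arcs[of "edges (hypercube n)" n] by (simp add: card_bool_lists card_cartesian_product mult.commute)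
qed

text \<open>An edge of \<open>Q\<^sub>n\<^sub>+\<^sub>1\<close> in direction \<open>d\<close> lies in one facet for every coordinate \<open>i\<close> other than \<open>d\<close>,
  hence in \<open>n\<close> facets.\<close>

lemma card_edges_le_sum_facets:
  assumes sub: "subgraph G (hypercube (Suc n))"
  shows "n * card (edges G) \<le> (\<Sum>i\<le>n. \<Sum>t\<in>UNIV. card (edges (facet n i t G)))"
proof -
  have G: "simple_graph G" and EG: "edges G \<subseteq> edges (hypercube (Suc n))"
    using sub by (auto simp: subgraph_def)
  have EF: "edges (facet n i t G) \<subseteq> edges (hypercube n)" for i t
    by (auto simp: facet_def pullback_graph_def)
  let ?A = "SIGMA (y, d):arcs (Suc n) (edges G). {..n} - {d}"
  let ?B = "SIGMA i:{..n}. SIGMA t:UNIV. arcs n (edges (facet n i t G))"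
  let ?g = "\<lambda>(i, t, x, d). ((insert_bit i t x, skip i d), i)"
  have finB: "finite ?B" by (intro finite_SigmaI finite_arcs) auto
  have "?A \<subseteq> ?g ` ?B"
  proof
    fix z assume "z \<in> ?A"
    then obtain y d i where z: "z = ((y, d), i)" and yd: "(y, d) \<in> arcs (Suc n) (edges G)"
      and i: "i \<le> n" "i \<noteq> d" by auto
    have y: "length y = Suc n" "d < Suc n" "{y, flip_at {d} y} \<in> edges G"
      using yd by (auto simp: arcs_def)
    obtain t x where x: "length x = n" "y = insert_bit i t x"
      using insert_bit_cases y(1) i(1) by blast
    obtain d' where d': "d = skip i d'" using skip_cases i(2) by metis
    have d'n: "d' < n" using y(2) d' i(1) by (simp add: skip_less_iff)
    have "{x, flip_at {d'} x} \<in> edges (hypercube n)"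
      using x d'n by (auto simp: hypercube_edge_iff_flip)
    moreover have "insert_bit i t ` {x, flip_at {d'} x} = {y, flip_at {d} y}"
      using flip_at_insert_bit[of i x "{d'}" t] x i d' by simp
    ultimately have "(x, d') \<in> arcs n (edges (facet n i t G))"
      using x d'n y(3) by (simp add: arcs_def facet_def pullback_graph_def)
    then have "(i, t, x, d') \<in> ?B" using i by auto
    then show "z \<in> ?g ` ?B" using z x d' by force
  qed
  then have "card ?A \<le> card ?B" by (rule surj_card_le[OF finB])
  moreover have "card ?A = (\<Sum>(y, d)\<in>arcs (Suc n) (edges G). n)"
  proof (subst card_SigmaI[OF finite_arcs])
    show "(\<Sum>p\<in>arcs (Suc n) (edges G). card (case p of (y, d) \<Rightarrow> {..n} - {d}))
        = (\<Sum>(y, d)\<in>arcs (Suc n) (edges G). n)"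
      by (intro sum.cong refl) (auto simp: arcs_def)
  qed auto
  moreover have "card ?B = (\<Sum>i\<le>n. \<Sum>t\<in>UNIV. card (arcs n (edges (facet n i t G))))"
    by (simp add: finite_arcs)
  moreover have "(\<Sum>(y, d)\<in>arcs (Suc n) (edges G). n) = 2 * card (edges G) * n"
    using card_arcs[OF EG] by (simp add: case_prod_unfold)
  ultimately have "2 * card (edges G) * n \<le> (\<Sum>i\<le>n. \<Sum>t\<in>UNIV. 2 * card (edges (facet n i t G)))"
    by (simp only: card_arcs[OF EF])
  also have "\<dots> = 2 * (\<Sum>i\<le>n. \<Sum>t\<in>UNIV. card (edges (facet n i t G)))"
    by (simp add: sum_distrib_left)
  finally show ?thesis by (simp add: mult.commute)
qed

text \<open>A corner \<open>(x, a, b, c)\<close> can lie in a facet only if the coordinate fixed there is none of the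
  three directions; this leaves \<open>n - 2\<close> of the \<open>n + 1\<close> coordinates.\<close>

lemma sum_facets_card_corners_le:
  "(\<Sum>i\<le>n. \<Sum>t\<in>UNIV. card (corners n (edges (facet n i t G))))
     \<le> (n - 2) * card (corners (Suc n) (edges G))"
proof -
  let ?B = "SIGMA i:{..n}. SIGMA t:UNIV. corners n (edges (facet n i t G))"
  let ?A = "SIGMA (y, a, b, c):corners (Suc n) (edges G). {..n} - {a, b, c}"
  let ?g = "\<lambda>(i, t, x, a, b, c). ((insert_bit i t x, skip i a, skip i b, skip i c), i)"
  have finA: "finite ?A" by (intro finite_SigmaI finite_corners) auto
  have "inj_on ?g ?B"
  proof (rule inj_onI)
    fix p q assume pq: "p \<in> ?B" "q \<in> ?B" "?g p = ?g q"
    obtain i t x a b c where p: "p = (i, t, x, a, b, c)" by (cases p)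
    obtain j s y a' b' c' where q: "q = (j, s, y, a', b', c')" by (cases q)
    have "i \<le> n" "length x = n" "length y = n" using pq p q by (auto simp: corners_def)
    then show "p = q" using pq(3) insert_bit_eq_iff[of x n y i t s] unfolding p q by auto
  qed
  moreover have "?g ` ?B \<subseteq> ?A"
    using corner_facet[of n _ _ G] by (auto simp: corners_def skip_less_iff)
  ultimately have "card ?B \<le> card ?A" using finA by (rule card_inj_on_le)
  moreover have "card ?B = (\<Sum>i\<le>n. \<Sum>t\<in>UNIV. card (corners n (edges (facet n i t G))))"
    by (simp add: finite_corners)
  moreover have "card ?A = (\<Sum>(y, a, b, c)\<in>corners (Suc n) (edges G). n - 2)"
  proof (subst card_SigmaI[OF finite_corners])
    show "(\<Sum>p\<in>corners (Suc n) (edges G). card (case p of (y, a, b, c) \<Rightarrow> {..n} - {a, b, c}))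
        = (\<Sum>(y, a, b, c)\<in>corners (Suc n) (edges G). n - 2)"
      by (intro sum.cong refl) (auto simp: corners_def card_Diff_subset)
  qed auto
  ultimately show ?thesis by (simp add: case_prod_unfold mult.commute)
qed

section \<open>Comparison of densities\<close>

definition ex_ratio :: "nat \<Rightarrow> 'b graph \<Rightarrow> real" where
  "ex_ratio n H = real (hypercube_ex n H) / real (card (edges (hypercube n)))"

lemma ex_ratio_eq: "ex_ratio n H = 2 * real (hypercube_ex n H) / (real n * 2 ^ n)"
proof -
  have "2 * real (card (edges (hypercube n))) = real n * 2 ^ n"
    using arg_cong[OF card_edges_hypercube[of n], of real] by simp
  then have "real (card (edges (hypercube n))) = real n * 2 ^ n / 2" by simp
  then show ?thesis by (simp only: ex_ratio_def) simp
qed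

lemma hypercube_ex_Suc_le:
  assumes "verts H \<noteq> {}"
  shows "n * hypercube_ex (Suc n) H \<le> 2 * Suc n * hypercube_ex n H"
proof -
  obtain G where sub: "subgraph G (hypercube (Suc n))" and free: "graph_free H G"
    and c: "card (edges G) = hypercube_ex (Suc n) H"
    using hypercube_ex_attained[OF assms] by blast
  have G: "simple_graph G" using sub by (simp add: subgraph_def)
  have "n * hypercube_ex (Suc n) H \<le> (\<Sum>i\<le>n. \<Sum>t\<in>UNIV. card (edges (facet n i t G)))"
    using card_edges_le_sum_facets[OF sub] c by simp
  also have "\<dots> \<le> (\<Sum>i\<le>n. \<Sum>t\<in>(UNIV :: bool set). hypercube_ex n H)"
    using G free
    by (intro sum_mono card_edges_le_hypercube_ex subgraph_facet graph_free_facet) auto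
  finally show ?thesis by simp
qed

text \<open>By averaging an extremal graph over the facets, the ratio does not increase from dimension 1 on; in
  dimension 0 it is \<open>0 / 0\<close>, so that the sequence has to be shifted.\<close>

lemma ex_ratio_convergent:
  assumes "verts H \<noteq> {}"
  shows "convergent (\<lambda>n. ex_ratio n H)"
proof -
  have step: "ex_ratio (Suc n) H \<le> ex_ratio n H" if "n \<ge> 1" for n
  proof -
    have "real (n * hypercube_ex (Suc n) H) \<le> real (2 * Suc n * hypercube_ex n H)"
      using hypercube_ex_Suc_le[OF assms] of_nat_le_iff by blast
    then have "real n * real (hypercube_ex (Suc n) H) \<le> 2 * real (Suc n) * real (hypercube_ex n H)"
      by (simp only: of_nat_mult of_nat_numeral)
    then show ?thesis using that
      by (simp add: ex_ratio_eq divide_simps del: of_nat_Suc) (simp add: algebra_simps)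
  qed
  have "convergent (\<lambda>n. ex_ratio (Suc n) H)"
  proof (rule Bseq_monoseq_convergent)
    have dec: "decseq (\<lambda>n. ex_ratio (Suc n) H)" using step by (intro decseq_SucI) simp
    then show "monoseq (\<lambda>n. ex_ratio (Suc n) H)" by (rule decseq_imp_monoseq)
    show "Bseq (\<lambda>n. ex_ratio (Suc n) H)"
    proof (rule BseqI')
      fix n show "norm (ex_ratio (Suc n) H) \<le> ex_ratio (Suc 0) H"
        using decseqD[OF dec, of 0 n] by (simp add: ex_ratio_def)
    qed
  qed
  then show ?thesis using convergent_Suc_iff by blast
qed

text \<open>Divided by \<open>n 2\<^sup>n\<close>, this bounds the edge density by the extremal density for \<open>C\<^sub>6\<close> in dimension \<open>m\<close>
  plus the density of corners, scaled by the number \<open>2\<^sup>m m (m - 1) (m - 2)\<close> of conceivable corners in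
  \<open>Q\<^sub>m\<close>. For \<open>n = m\<close> it holds because either there is no hexagon, or there is at least one corner and
  the second term is at least the number \<open>m 2\<^sup>m\<close> of all arcs of \<open>Q\<^sub>m\<close>. The step to \<open>n + 1\<close> averages over
  the facets: the factor \<open>n - 2\<close> by which corners are shared among facets cancels against the denominator.\<close>

lemma edge_density_le:
  assumes m: "3 \<le> m" and mn: "m \<le> n" and "subgraph G (hypercube n)"
  shows "2 * real (card (edges G)) \<le> real n * 2 ^ n * ex_ratio m (cycle_graph 6) +
    real m * 2 ^ m * real (card (corners n (edges G))) * (real m - 1) * (real m - 2) / ((real n - 1) * (real n - 2))"
  using mn assms(3)
proof (induction n arbitrary: G rule: dec_induct)
  case base
  have mpos: "real m > 2" using m by simp
  show ?case
  proof (cases "graph_free (cycle_graph 6) G")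
    case True
    then have "real (card (edges G)) \<le> real (hypercube_ex m (cycle_graph 6))"
      using card_edges_le_hypercube_ex[OF base] by simp
    moreover have "real m * 2 ^ m * ex_ratio m (cycle_graph 6)
        = 2 * real (hypercube_ex m (cycle_graph 6))"
      using mpos by (simp add: ex_ratio_eq)
    ultimately show ?thesis using mpos by (simp add: add_increasing2)
  next
    case False
    then have "card (corners m (edges G)) \<ge> 1"
      using hexagon_imp_corner[OF base] finite_corners[of m "edges G"]
      by (simp add: Suc_le_eq card_gt_0_iff)
    then have c: "real (card (corners m (edges G))) \<ge> 1" by simp
    have "card (edges G) \<le> card (edges (hypercube m))"
      using base finite_edges_hypercube by (auto simp: subgraph_def intro: card_mono)
    then have "2 * card (edges G) \<le> m * 2 ^ m" using card_edges_hypercube[of m] by simp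
    then have "real (2 * card (edges G)) \<le> real (m * 2 ^ m)" using of_nat_le_iff by blast
    then have "2 * real (card (edges G)) \<le> real m * 2 ^ m" by simp
    also have "\<dots> \<le> real m * 2 ^ m * real (card (corners m (edges G)))"
      using mult_left_mono[OF c, of "real m * 2 ^ m"] by simp
    also have "\<dots> = real m * 2 ^ m * real (card (corners m (edges G))) * (real m - 1) * (real m - 2)
        / ((real m - 1) * (real m - 2))"
      using mpos by simp
    finally show ?thesis by (simp add: ex_ratio_def add_increasing)
  qed
next
  case (step n)
  have G: "simple_graph G" using step.prems by (simp add: subgraph_def)
  define r where "r = ex_ratio m (cycle_graph 6)"
  define M where "M = real m * 2 ^ m * (real m - 1) * (real m - 2)"
  have npos: "real n > 2" using m step.hyps by simp
  have M: "M \<ge> 0" using m by (simp add: M_def)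
  let ?c = "\<lambda>i t. real (card (corners n (edges (facet n i t G))))"
  have cor: "(\<Sum>i\<le>n. \<Sum>t\<in>UNIV. ?c i t) \<le> (real n - 2) * real (card (corners (Suc n) (edges G)))"
  proof -
    have "(\<Sum>i\<le>n. \<Sum>t\<in>UNIV. ?c i t)
        = real (\<Sum>i\<le>n. \<Sum>t\<in>UNIV. card (corners n (edges (facet n i t G))))" by simp
    also have "\<dots> \<le> real ((n - 2) * card (corners (Suc n) (edges G)))"
      using sum_facets_card_corners_le of_nat_le_iff by blast
    also have "\<dots> = (real n - 2) * real (card (corners (Suc n) (edges G)))"
      using npos by (simp add: of_nat_diff)
    finally show ?thesis .
  qed
  have "real n * (2 * real (card (edges G))) = 2 * real (n * card (edges G))" by simp
  also have "\<dots> \<le> 2 * real (\<Sum>i\<le>n. \<Sum>t\<in>UNIV. card (edges (facet n i t G)))"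
    using card_edges_le_sum_facets[OF step.prems] by (intro mult_left_mono of_nat_mono) auto
  also have "\<dots> = (\<Sum>i\<le>n. \<Sum>t\<in>UNIV. 2 * real (card (edges (facet n i t G))))"
    by (simp add: sum_distrib_left)
  also have "\<dots> \<le> (\<Sum>i\<le>n. \<Sum>t\<in>UNIV. real n * 2 ^ n * r + M / ((real n - 1) * (real n - 2)) * ?c i t)"
    using step.IH[OF subgraph_facet[OF G]]
    by (intro sum_mono) (simp add: r_def M_def mult_ac)
  also have "\<dots> = (\<Sum>i\<le>n. \<Sum>t\<in>(UNIV :: bool set). real n * 2 ^ n * r) +
      M / ((real n - 1) * (real n - 2)) * (\<Sum>i\<le>n. \<Sum>t\<in>UNIV. ?c i t)"
    by (simp only: sum.distrib sum_distrib_left)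
  also have "(\<Sum>i\<le>n. \<Sum>t\<in>(UNIV :: bool set). real n * 2 ^ n * r) = real n * (real (Suc n) * 2 ^ Suc n * r)"
    by (simp add: algebra_simps)
  also have "real n * (real (Suc n) * 2 ^ Suc n * r) +
      M / ((real n - 1) * (real n - 2)) * (\<Sum>i\<le>n. \<Sum>t\<in>UNIV. ?c i t)
    \<le> real n * (real (Suc n) * 2 ^ Suc n * r) +
      M / ((real n - 1) * (real n - 2)) * ((real n - 2) * real (card (corners (Suc n) (edges G))))"
    using cor M npos by (intro add_left_mono mult_left_mono) auto
  also have "\<dots> = real n * (real (Suc n) * 2 ^ Suc n * r +
      M * real (card (corners (Suc n) (edges G))) / ((real (Suc n) - 1) * (real (Suc n) - 2)))"
  proof -
    have Suc: "real (Suc n) - 1 = real n" "real (Suc n) - 2 = real n - 1" by simp_all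
    show ?thesis unfolding Suc using npos by (simp add: distrib_left)
  qed
  finally show ?case using npos by (simp add: r_def M_def mult_ac)
qed

lemma verts_cycle_graph: "0 < k \<Longrightarrow> verts (cycle_graph k) \<noteq> {}"
  by (auto simp: cycle_graph_def)

lemma ex_ratio_decagon_le:
  assumes "3 \<le> m" "m \<le> n"
  shows "ex_ratio n (cycle_graph 10) \<le> ex_ratio m (cycle_graph 6) +
    3 * (real m * 2 ^ m * (real m - 1) * (real m - 2)) * (real n / ((real n - 1) * (real n - 2)))"
proof -
  obtain G where sub: "subgraph G (hypercube n)" and free: "graph_free (cycle_graph 10) G"
    and c: "card (edges G) = hypercube_ex n (cycle_graph 10)"
    using hypercube_ex_attained[OF verts_cycle_graph] by (metis zero_less_numeral)
  define M where "M = real m * 2 ^ m * (real m - 1) * (real m - 2)"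
  define N where "N = (real n - 1) * (real n - 2)"
  define r where "r = ex_ratio m (cycle_graph 6)"
  have npos: "real n > 2" using assms by simp
  have M: "M \<ge> 0" using assms by (simp add: M_def)
  have N: "N > 0" using npos by (simp add: N_def)
  have "real (card (corners n (edges G))) \<le> real (2 ^ n * (n * (3 * n)))"
    using card_corners_le[OF sub free] of_nat_le_iff by blast
  then have cor: "real (card (corners n (edges G))) \<le> 3 * 2 ^ n * real n * real n"
    by (simp add: mult_ac)
  have "2 * real (hypercube_ex n (cycle_graph 10))
      \<le> real n * 2 ^ n * r + M * real (card (corners n (edges G))) / N"
    using edge_density_le[OF assms sub] c by (simp add: r_def M_def N_def mult_ac)
  also have "\<dots> \<le> real n * 2 ^ n * r + M * (3 * 2 ^ n * real n * real n) / N"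
    using cor M N by (intro add_left_mono divide_right_mono mult_left_mono) auto
  also have "\<dots> = (r + 3 * M * (real n / N)) * (real n * 2 ^ n)"
    using N by (simp add: field_simps)
  finally have "ex_ratio n (cycle_graph 10) \<le> r + 3 * M * (real n / N)"
    using npos by (simp add: ex_ratio_eq pos_divide_le_eq)
  then show ?thesis by (simp add: r_def M_def N_def)
qed

lemma decagon_error_tendsto_0: "(\<lambda>n. real n / ((real n - 1) * (real n - 2))) \<longlonglongrightarrow> 0"
proof (rule tendsto_sandwich[OF _ _ tendsto_const])
  show "\<forall>\<^sub>F n in sequentially. 0 \<le> real n / ((real n - 1) * (real n - 2))"
    using eventually_ge_at_top[of 3] by eventually_elim simp
  show "\<forall>\<^sub>F n in sequentially. real n / ((real n - 1) * (real n - 2)) \<le> 6 / real n"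
    using eventually_ge_at_top[of 4]
  proof eventually_elim
    case (elim n)
    then have n: "real n \<ge> 4" by simp
    have "real n * real n \<le> 6 * ((real n - 1) * (real n - 2))"
    proof -
      have "4 * real n \<le> real n * real n" using n by (intro mult_right_mono) auto
      then show ?thesis using n unfolding left_diff_distrib right_diff_distrib by linarith
    qed
    then show ?case using n by (simp add: field_simps)
  qed
  show "(\<lambda>n. 6 / real n) \<longlonglongrightarrow> 0" by (rule lim_const_over_n)
qed

theorem theorem1p1:
  "hypercube_turan_density (cycle_graph 10) \<le> hypercube_turan_density (cycle_graph 6)"
proof -
  have lim: "(\<lambda>n. ex_ratio n (cycle_graph k)) \<longlonglongrightarrow> hypercube_turan_density (cycle_graph k)"
    if "0 < k" for k
    using ex_ratio_convergent[OF verts_cycle_graph[OF that]]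
    by (simp add: hypercube_turan_density_def ex_ratio_def convergent_LIMSEQ_iff)
  have "hypercube_turan_density (cycle_graph 10) \<le> ex_ratio m (cycle_graph 6)" if m: "3 \<le> m" for m
  proof (rule LIMSEQ_le)
    show "(\<lambda>n. ex_ratio n (cycle_graph 10)) \<longlonglongrightarrow> hypercube_turan_density (cycle_graph 10)"
      by (rule lim) simp
    let ?M = "3 * (real m * 2 ^ m * (real m - 1) * (real m - 2))"
    show "(\<lambda>n. ex_ratio m (cycle_graph 6) + ?M * (real n / ((real n - 1) * (real n - 2))))
        \<longlonglongrightarrow> ex_ratio m (cycle_graph 6)"
      using tendsto_add[OF tendsto_const tendsto_mult_right_zero[OF decagon_error_tendsto_0]]
      by simp
    show "\<exists>N. \<forall>n\<ge>N. ex_ratio n (cycle_graph 10)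
        \<le> ex_ratio m (cycle_graph 6) + ?M * (real n / ((real n - 1) * (real n - 2)))"
      using ex_ratio_decagon_le[OF m] by blast
  qed
  then show ?thesis using lim[of 6] by (intro LIMSEQ_le_const) auto
qed

end
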